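(* Let $\mathcal{L}_{ij} := \mathcal{L}_{ij}^+ \cup \mathcal{L}_{ij}^- \cup \mathcal{L}_{ij}^0\subseteq\mathbb{R}^5$ be the compression set, where $\mathcal{L}_{ij}^+,\mathcal{L}_{ij}^-,\mathcal{L}_{ij}^0$ are defined in the context. Then $\mathrm{conv}(\mathcal{L}_{ij})$ is power cone representable (POWr).
   Context: Data: real numbers $0<\underline{\pi}_i\le\bar{\pi}_i$, $0<\underline{\pi}_j\le\bar{\pi}_j$, $\underline{f}_{ij}<0<\bar f_{ij}$, $1<\underline r_{ij}<\bar r_{ij}$, $H_{ij}>0$, $\hat\kappa\in(0,1)$. Define $$\Pi_{ij} := \{(\pi_i, \pi_j) \in [\underline{\pi}_{i}, \bar{\pi}_{i}]\times [\underline{\pi}_{j}, \bar{\pi}_{j}] : \underline{r}_{ij} \le \pi_j/\pi_i \le \bar{r}_{ij}\},\quad \Pi_{ji} := \{(\pi_i, \pi_j) \in [\underline{\pi}_{i}, \bar{\pi}_{i}]\times [\underline{\pi}_{j}, \bar{\pi}_{j}] : \underline{r}_{ij} \le \pi_i/\pi_j \le \bar{r}_{ij}\},$$ $$\mathcal{L}_{ij}^+ := \{ (\pi_i, \pi_j, f_{ij}, l_{ij}, x_{ij}) \in \mathbb{R}^4 \times \{1\}: l_{ij} = H_{ij}((\pi_{j}/\pi_{i})^{\hat{\kappa}} -1) f_{ij},\ (\pi_i, \pi_j) \in \Pi_{ij},\ f_{ij} \in [0, \bar{f}_{ij}] \},$$ $$\mathcal{L}_{ij}^- := \{ (\pi_i,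 \pi_j, f_{ij}, l_{ij}, x_{ij}) \in \mathbb{R}^4 \times \{1\}: l_{ij} = H_{ij}((\pi_{i}/\pi_{j})^{\hat{\kappa}} -1) f_{ij},\ (\pi_i, \pi_j) \in \Pi_{ji},\ f_{ij} \in [\underline{f}_{ij}, 0] \},$$ $$\mathcal{L}_{ij}^0 := \{ (\pi_i, \pi_j, f_{ij}, l_{ij}, x_{ij}) \in \mathbb{R}^2 \times \{0\}^3: \underline{\pi}_i \le \pi_i \le \bar{\pi}_i,\ \underline{\pi}_j \le \pi_j \le \bar{\pi}_j\}.$$ For $a\in[0,1]$ the power cone is $\mathbf{P}_a:=\{x\in\mathbb{R}^3: x_1^a x_2^{1-a}\ge|x_3|,\ x_1,x_2\ge0\}$. A convex set $Y\subseteq\mathbb{R}^n$ is power cone representable (POWr) if there are $m$, an affine map $T$ and a cone $K$ that is a finite product of power cones such that $Y=\{x\in\mathbb{R}^n:\exists w\in\mathbb{R}^m,\ T(x,w)\in K\}$. $\mathrm{conv}$ denotes convex hull. *)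

theory Defs
  imports "HOL-Analysis.Analysis"
begin

text \<open>
  Real power of a nonnegative base with the convention \<open>0 ^ 0 = 1\<close>. The library's \<open>powr\<close>
  has \<open>0 powr 0 = 0\<close>, with which the power cones for the exponents 0 and 1 would not be closed.
\<close>

definition rpow :: "real \<Rightarrow> real \<Rightarrow> real" where
  "rpow x a = (if a = 0 then 1 else x powr a)"

definition power_cone :: "real \<Rightarrow> (real \<times> real \<times> real) set" where
  "power_cone a =
    {(x1, x2, x3). rpow x1 a * rpow x2 (1 - a) \<ge> \<bar>x3\<bar> \<and> x1 \<ge> 0 \<and> x2 \<ge> 0}"

text \<open>
  Since the dimension \<open>m\<close> is quantified inside the definition of representability, a vector of
  \<open>\<real>\<^sup>m\<close> is given by the values \<open>w 0, \<dots>, w (m - 1)\<close> of a sequence \<open>w\<close>; an affine map on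
  \<open>'a \<times> \<real>\<^sup>m\<close> depends on no other values of \<open>w\<close>.
\<close>

definition affine_map ::
    "nat \<Rightarrow> ('a::real_vector \<Rightarrow> (nat \<Rightarrow> real) \<Rightarrow> 'b::real_vector) \<Rightarrow> bool" where
  "affine_map m T \<longleftrightarrow>
    (\<exists>A B c. linear A \<and> (\<forall>x w. T x w = A x + (\<Sum>i<m. w i *\<^sub>R B i) + c))"

text \<open>
  The cone is the product of the power cones with exponents \<open>a 0, \<dots>, a (k - 1)\<close>, and \<open>T j\<close> is the
  component of the affine map that goes to the \<open>j\<close>-th factor.
\<close>

definition power_cone_representable :: "'a::euclidean_space set \<Rightarrow> bool" where
  "power_cone_representable Y \<longleftrightarrow>
    convex Y \<and>
    (\<exists>m k (a :: nat \<Rightarrow> real) (T :: nat \<Rightarrow> 'a \<Rightarrow> (nat \<Rightarrow> real) \<Rightarrow> real \<times> real \<times> real).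
      (\<forall>j<k. a j \<in> {0..1}) \<and>
      (\<forall>j<k. affine_map m (T j)) \<and>
      Y = {x. \<exists>w. \<forall>j<k. T j x w \<in> power_cone (a j)})"

text \<open>
  Below, \<open>pl_i\<close>, \<open>pu_i\<close>, \<open>pl_j\<close>, \<open>pu_j\<close> are the lower and upper bounds of \<open>\<pi>\<^sub>i\<close> and \<open>\<pi>\<^sub>j\<close>;
  \<open>rl\<close>, \<open>ru\<close> those of the compression ratio; \<open>fl\<close>, \<open>fu\<close> those of the flow \<open>f\<^sub>i\<^sub>j\<close>.
  Points of \<open>\<real>\<^sup>5\<close> are tuples \<open>(\<pi>\<^sub>i, \<pi>\<^sub>j, f\<^sub>i\<^sub>j, l\<^sub>i\<^sub>j, x\<^sub>i\<^sub>j)\<close>.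
\<close>

definition Pi_ij ::
    "real \<Rightarrow> real \<Rightarrow> real \<Rightarrow> real \<Rightarrow> real \<Rightarrow> real \<Rightarrow> (real \<times> real) set" where
  "Pi_ij pl_i pu_i pl_j pu_j rl ru =
    {(p_i, p_j) \<in> {pl_i..pu_i} \<times> {pl_j..pu_j}. rl \<le> p_j / p_i \<and> p_j / p_i \<le> ru}"

definition Pi_ji ::
    "real \<Rightarrow> real \<Rightarrow> real \<Rightarrow> real \<Rightarrow> real \<Rightarrow> real \<Rightarrow> (real \<times> real) set" where
  "Pi_ji pl_i pu_i pl_j pu_j rl ru =
    {(p_i, p_j) \<in> {pl_i..pu_i} \<times> {pl_j..pu_j}. rl \<le> p_i / p_j \<and> p_i / p_j \<le> ru}"

definition L_plus ::
    "real \<Rightarrow> real \<Rightarrow> real \<Rightarrow> real \<Rightarrow> real \<Rightarrow> real \<Rightarrow> real \<Rightarrow> real \<Rightarrow> real \<Rightarrow>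
     (real \<times> real \<times> real \<times> real \<times> real) set" where
  "L_plus pl_i pu_i pl_j pu_j rl ru fu H \<kappa> =
    {(p_i, p_j, f, l, x). x = 1 \<and> l = H * ((p_j / p_i) powr \<kappa> - 1) * f \<and>
      (p_i, p_j) \<in> Pi_ij pl_i pu_i pl_j pu_j rl ru \<and> f \<in> {0..fu}}"

definition L_minus ::
    "real \<Rightarrow> real \<Rightarrow> real \<Rightarrow> real \<Rightarrow> real \<Rightarrow> real \<Rightarrow> real \<Rightarrow> real \<Rightarrow> real \<Rightarrow>
     (real \<times> real \<times> real \<times> real \<times> real) set" where
  "L_minus pl_i pu_i pl_j pu_j rl ru fl H \<kappa> =
    {(p_i, p_j, f, l, x). x = 1 \<and> l = H * ((p_i / p_j) powr \<kappa> - 1) * f \<and>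
      (p_i, p_j) \<in> Pi_ji pl_i pu_i pl_j pu_j rl ru \<and> f \<in> {fl..0}}"

definition L_zero ::
    "real \<Rightarrow> real \<Rightarrow> real \<Rightarrow> real \<Rightarrow> (real \<times> real \<times> real \<times> real \<times> real) set" where
  "L_zero pl_i pu_i pl_j pu_j =
    {(p_i, p_j, f, l, x). f = 0 \<and> l = 0 \<and> x = 0 \<and>
      pl_i \<le> p_i \<and> p_i \<le> pu_i \<and> pl_j \<le> p_j \<and> p_j \<le> pu_j}"

definition compression_set ::
    "real \<Rightarrow> real \<Rightarrow> real \<Rightarrow> real \<Rightarrow> real \<Rightarrow> real \<Rightarrow> real \<Rightarrow> real \<Rightarrow> real \<Rightarrow> real \<Rightarrow>
     (real \<times> real \<times> real \<times> real \<times> real) set" where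
  "compression_set pl_i pu_i pl_j pu_j rl ru fl fu H \<kappa> =
    L_plus pl_i pu_i pl_j pu_j rl ru fu H \<kappa> \<union>
    L_minus pl_i pu_i pl_j pu_j rl ru fl H \<kappa> \<union>
    L_zero pl_i pu_i pl_j pu_j"

end

theory Submission
  imports Defs
begin

text \<open>
  Power cone representable sets are closed under intersection, affine preimage, projection and, when
  bounded, under the convex hull of unions (via homogenization). For \<open>L_plus\<close> only the slices \<open>f = 0\<close>
  (a polytope) and \<open>f = fu\<close> matter, the latter being an affine copy of the graph of
  \<open>(q / p) powr \<kappa>\<close> over a polygon. This function is concave in \<open>q\<close> and convex in \<open>p\<close>, so the convex
  hull of its graph is bounded below by the hull of its restriction to the edges \<open>q = const\<close> and
  above by that to the edges \<open>p = const\<close>, together in both cases with the edges \<open>q = r * p\<close>, where it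
  is constant. On the edges \<open>q = const\<close> and \<open>p = const\<close>, the epigraph and the hypograph respectively
  are slices of power cones.
\<close>

section \<open>The power cone\<close>

lemma rpow_nonneg: "0 \<le> rpow x a"
  by (simp add: rpow_def)

lemma power_cone_zero: "0 \<in> power_cone a"
  by (simp add: power_cone_def zero_prod_def rpow_nonneg)

text \<open>The exponents add up to 1, so the weighted geometric mean is homogeneous of degree 1.
  For the exponents 0 and 1 one factor is 1, even at base 0, by the convention in
  \<open>rpow\<close>.\<close>

lemma rpow_scale_prod:
  assumes "a \<in> {0..1}" "0 \<le> t" "0 \<le> x" "0 \<le> y"
  shows "rpow (t * x) a * rpow (t * y) (1 - a) = t * (rpow x a * rpow y (1 - a))"
proof -
  have "t powr a * t powr (1 - a) = t" if "0 < a" "a < 1"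
    using that assms by (cases "t = 0") (simp_all flip: powr_add)
  then show ?thesis
    using assms by (auto simp: rpow_def powr_mult mult_ac)
qed

lemma power_cone_scaleR:
  assumes "a \<in> {0..1}" "0 \<le> t" "u \<in> power_cone a"
  shows "t *\<^sub>R u \<in> power_cone a"
  using assms
  by (cases u) (auto simp: power_cone_def rpow_scale_prod abs_mult intro: mult_left_mono)

text \<open>A two-term Hoelder inequality. Each pair is normalized by the coordinatewise sums,
  Young's inequality bounds the normalized means, and the two bounds together give exactly the mean
  of the sums.\<close>

lemma powr_prod_superadd:
  assumes a: "0 < a" "a < (1::real)"
    and nn: "0 \<le> x1" "0 \<le> x2" "0 \<le> y1" "0 \<le> y2"
  shows "x1 powr a * x2 powr (1 - a) + y1 powr a * y2 powr (1 - a)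
    \<le> (x1 + y1) powr a * (x2 + y2) powr (1 - a)"
proof (cases "x1 + y1 = 0 \<or> x2 + y2 = 0")
  case True
  \<comment> \<open>Nonnegative numbers with sum 0 both vanish, so each product on the left has a
    zero base.\<close>
  then have "x1 = 0 \<and> y1 = 0 \<or> x2 = 0 \<and> y2 = 0" using nn by linarith
  then show ?thesis by auto
next
  case False
  define s t where "s = x1 + y1" and "t = x2 + y2"
  have st: "0 < s" "0 < t" using False nn by (auto simp: s_def t_def)
  have young: "u powr a * v powr (1 - a) \<le> (a * (u / s) + (1 - a) * (v / t)) * (s powr a * t powr (1 - a))"
    if "0 \<le> u" "0 \<le> v" for u v
  proof -
    have "(u / s) powr a * (v / t) powr (1 - a) \<le> a * (u / s) + (1 - a) * (v / t)"
    proof (cases "u = 0 \<or> v = 0")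
      case True
      then show ?thesis using that a st by auto
    next
      case False
      then show ?thesis using that a st by (intro Youngs_inequality_0) auto
    qed
    then have "(u / s) powr a * (v / t) powr (1 - a) * (s powr a * t powr (1 - a))
        \<le> (a * (u / s) + (1 - a) * (v / t)) * (s powr a * t powr (1 - a))"
      by (rule mult_right_mono) simp
    moreover have "(u / s) powr a * (v / t) powr (1 - a) * (s powr a * t powr (1 - a))
        = u powr a * v powr (1 - a)"
      using st that by (simp add: powr_divide)
    ultimately show ?thesis by simp
  qed
  \<comment> \<open>The two coefficients from \<open>young\<close> add up to 1 because
    \<open>s\<close> and \<open>t\<close> are the coordinatewise sums.\<close>
  have "a * (x1 / s) + (1 - a) * (x2 / t) + (a * (y1 / s) + (1 - a) * (y2 / t))
      = a * ((x1 + y1) / s) + (1 - a) * ((x2 + y2) / t)"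
    by (simp add: add_divide_distrib algebra_simps)
  also have "\<dots> = 1" using st by (simp add: s_def t_def)
  finally show ?thesis
    using add_mono[OF young[of x1 x2] young[of y1 y2]] nn
    by (simp add: s_def t_def flip: distrib_right)
qed

text \<open>Together with \<open>power_cone_scaleR\<close> this makes the factors convex cones. For
  the exponents 0 and 1 the bound is a single coordinate, hence additive; in between it is
  superadditive.\<close>

lemma power_cone_add:
  assumes a: "a \<in> {0..1}" and u: "u \<in> power_cone a" and v: "v \<in> power_cone a"
  shows "u + v \<in> power_cone a"
proof -
  obtain x1 x2 x3 y1 y2 y3 where [simp]: "u = (x1, x2, x3)" "v = (y1, y2, y3)"
    by (metis prod_cases3)
  have nn: "0 \<le> x1" "0 \<le> x2" "0 \<le> y1" "0 \<le> y2"
    and bd: "\<bar>x3\<bar> \<le> rpow x1 a * rpow x2 (1 - a)" "\<bar>y3\<bar> \<le> rpow y1 a * rpow y2 (1 - a)"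
    using u v by (auto simp: power_cone_def)
  have "rpow x1 a * rpow x2 (1 - a) + rpow y1 a * rpow y2 (1 - a)
      \<le> rpow (x1 + y1) a * rpow (x2 + y2) (1 - a)"
    using a nn powr_prod_superadd[of a x1 x2 y1 y2] by (auto simp: rpow_def)
  then show ?thesis
    using nn bd by (auto simp: power_cone_def)
qed

section \<open>Closure properties of representable sets\<close>

text \<open>A normal form with the affine maps written out: in factor \<open>j\<close>,
  \<open>A j\<close> is the linear part, \<open>B j i\<close> the column of the auxiliary variable
  \<open>w i\<close>, and \<open>c j\<close> the offset. The closure properties are proved by
  editing these data.\<close>

definition cone_system ::
    "nat \<Rightarrow> nat \<Rightarrow> (nat \<Rightarrow> real) \<Rightarrow> (nat \<Rightarrow> 'a::euclidean_space \<Rightarrow> real \<times> real \<times> real) \<Rightarrow>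
     (nat \<Rightarrow> nat \<Rightarrow> real \<times> real \<times> real) \<Rightarrow> (nat \<Rightarrow> real \<times> real \<times> real) \<Rightarrow> 'a set" where
  "cone_system m k a A B c =
    {x. \<exists>w. \<forall>j<k. A j x + (\<Sum>i<m. w i *\<^sub>R B j i) + c j \<in> power_cone (a j)}"

text \<open>The auxiliary variables are averaged with the same weights as the points; the offset is
  recovered because the weights sum to 1.\<close>

lemma convex_cone_system:
  assumes "\<forall>j<k. a j \<in> {0..1} \<and> linear (A j)"
  shows "convex (cone_system m k a A B c)"
proof (rule convexI)
  fix x y and u v :: real
  assume uv: "0 \<le> u" "0 \<le> v" "u + v = 1"
  assume "x \<in> cone_system m k a A B c" "y \<in> cone_system m k a A B c"
  then obtain w1 w2
    where w1: "\<And>j. j < k \<Longrightarrow> A j x + (\<Sum>i<m. w1 i *\<^sub>R B j i) + c j \<in> power_cone (a j)"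
      and w2: "\<And>j. j < k \<Longrightarrow> A j y + (\<Sum>i<m. w2 i *\<^sub>R B j i) + c j \<in> power_cone (a j)"
    unfolding cone_system_def by blast
  define w where "w i = u * w1 i + v * w2 i" for i
  have "A j (u *\<^sub>R x + v *\<^sub>R y) + (\<Sum>i<m. w i *\<^sub>R B j i) + c j \<in> power_cone (a j)" if j: "j < k" for j
  proof -
    have "u *\<^sub>R (A j x + (\<Sum>i<m. w1 i *\<^sub>R B j i) + c j)
        + v *\<^sub>R (A j y + (\<Sum>i<m. w2 i *\<^sub>R B j i) + c j)
        = A j (u *\<^sub>R x + v *\<^sub>R y) + (\<Sum>i<m. w i *\<^sub>R B j i) + (u + v) *\<^sub>R c j"
      using assms j
      by (simp add: linear_add linear_scale w_def scaleR_add_right scaleR_add_left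
          sum.distrib scaleR_sum_right)
    then have eq: "A j (u *\<^sub>R x + v *\<^sub>R y) + (\<Sum>i<m. w i *\<^sub>R B j i) + c j
        = u *\<^sub>R (A j x + (\<Sum>i<m. w1 i *\<^sub>R B j i) + c j)
        + v *\<^sub>R (A j y + (\<Sum>i<m. w2 i *\<^sub>R B j i) + c j)"
      using uv by simp
    show ?thesis
      unfolding eq using uv assms j by (intro power_cone_add power_cone_scaleR w1 w2) auto
  qed
  then show "u *\<^sub>R x + v *\<^sub>R y \<in> cone_system m k a A B c"
    unfolding cone_system_def mem_Collect_eq by (intro exI[of _ w] allI impI)
qed

text \<open>The convexity clause of the definition follows from the form of the system, so a
  representation amounts to its data alone.\<close>

lemma power_cone_representable_iff:
  "power_cone_representable Y \<longleftrightarrow>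
    (\<exists>m k a A B c. (\<forall>j<k. a j \<in> {0..1} \<and> linear (A j)) \<and> Y = cone_system m k a A B c)"
proof
  assume "power_cone_representable Y"
  then obtain m and k :: nat and a T where a: "\<forall>j<k. a j \<in> {0..1}" and T: "\<forall>j<k. affine_map m (T j)"
    and Y: "Y = {x. \<exists>w. \<forall>j<k. T j x w \<in> power_cone (a j)}"
    unfolding power_cone_representable_def by blast
  \<comment> \<open>The bound on \<open>j\<close> moves inside the existentials so that
    \<open>choice\<close> applies to all indices at once.\<close>
  from T have "\<forall>j. \<exists>A B c. j < k \<longrightarrow> linear A \<and>
      (\<forall>x w. T j x w = A x + (\<Sum>i<m. w i *\<^sub>R B i) + c)"
    unfolding affine_map_def by simp
  from choice[OF this] obtain A where "\<forall>j. \<exists>B c. j < k \<longrightarrow> linear (A j) \<and>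
      (\<forall>x w. T j x w = A j x + (\<Sum>i<m. w i *\<^sub>R B i) + c)" ..
  from choice[OF this] obtain B where "\<forall>j. \<exists>c. j < k \<longrightarrow> linear (A j) \<and>
      (\<forall>x w. T j x w = A j x + (\<Sum>i<m. w i *\<^sub>R B j i) + c)" ..
  from choice[OF this] obtain c where
    A: "\<And>j. j < k \<Longrightarrow> linear (A j)" and
    eq: "\<And>j x w. j < k \<Longrightarrow> T j x w = A j x + (\<Sum>i<m. w i *\<^sub>R B j i) + c j" by blast
  have "Y = cone_system m k a A B c"
    by (simp add: Y cone_system_def eq cong: imp_cong)
  with a A have *: "(\<forall>j<k. a j \<in> {0..1} \<and> linear (A j)) \<and> Y = cone_system m k a A B c"
    by simp
  show "\<exists>m k a A B c. (\<forall>j<k. a j \<in> {0..1} \<and> linear (A j)) \<and> Y = cone_system m k a A B c"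
    by (rule exI[of _ m], rule exI[of _ k], rule exI[of _ a], rule exI[of _ A],
        rule exI[of _ B], rule exI[of _ c], rule *)
next
  assume "\<exists>m k a A B c. (\<forall>j<k. a j \<in> {0..1} \<and> linear (A j)) \<and> Y = cone_system m k a A B c"
  then obtain m k a A B c
    where *: "\<forall>j<k. a j \<in> {0..1} \<and> linear (A j)" and Y: "Y = cone_system m k a A B c"
    by blast
  show "power_cone_representable Y"
    unfolding power_cone_representable_def
  proof (intro conjI exI)
    show "convex Y" using convex_cone_system[OF *] Y by simp
    show "\<forall>j<k. a j \<in> {0..1}" using * by simp
    show "\<forall>j<k. affine_map m (\<lambda>x w. A j x + (\<Sum>i<m. w i *\<^sub>R B j i) + c j)"
      using * unfolding affine_map_def by blast
  qed (simp add: Y cone_system_def)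
qed

lemma power_cone_representable_cone_system:
  "\<forall>j<k. a j \<in> {0..1} \<and> linear (A j) \<Longrightarrow> power_cone_representable (cone_system m k a A B c)"
  unfolding power_cone_representable_iff by blast

lemma power_cone_representable_imp_convex: "power_cone_representable Y \<Longrightarrow> convex Y"
  by (simp add: power_cone_representable_def)

lemma sum_lessThan_add:
  "(\<Sum>i<m + n. f i) = (\<Sum>i<m. f i) + (\<Sum>i<n. f (m + i))"
  for f :: "nat \<Rightarrow> 'a::comm_monoid_add"
  by (induction n) (auto simp: add_ac)

lemma all_less_add: "(\<forall>j<k + l. P j) \<longleftrightarrow> (\<forall>j<k. P j) \<and> (\<forall>j<l. P (k + j))" for k l :: nat
  by (metis add_less_cancel_left le_add_diff_inverse not_less trans_less_add1)

lemma power_cone_representable_power_cone: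
  assumes "a \<in> {0..1}" "linear f"
  shows "power_cone_representable {x. f x + c \<in> power_cone a}"
proof -
  have "{x. f x + c \<in> power_cone a} = cone_system 0 1 (\<lambda>_. a) (\<lambda>_. f) (\<lambda>_ _. 0) (\<lambda>_. c)"
    by (simp add: cone_system_def)
  then show ?thesis
    using power_cone_representable_cone_system[of 1 "\<lambda>_. a" "\<lambda>_. f"] assms by simp
qed

text \<open>The two systems are stacked: the factors are concatenated and each system keeps its own
  auxiliary variables.\<close>

lemma power_cone_representable_Int:
  assumes "power_cone_representable X" "power_cone_representable Y"
  shows "power_cone_representable (X \<inter> Y)"
proof -
  from assms obtain m1 k1 a1 A1 B1 c1 m2 k2 a2 A2 B2 c2
    where 1: "\<forall>j<k1. a1 j \<in> {0..1} \<and> linear (A1 j)" and X: "X = cone_system m1 k1 a1 A1 B1 c1"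
      and 2: "\<forall>j<k2. a2 j \<in> {0..1} \<and> linear (A2 j)" and Y: "Y = cone_system m2 k2 a2 A2 B2 c2"
    unfolding power_cone_representable_iff by blast
  define a where "a j = (if j < k1 then a1 j else a2 (j - k1))" for j
  define A where "A j = (if j < k1 then A1 j else A2 (j - k1))" for j
  define c where "c j = (if j < k1 then c1 j else c2 (j - k1))" for j
  \<comment> \<open>Block diagonal: zero columns decouple each system from the variables of the
    other.\<close>
  define B where "B j i = (if j < k1 then if i < m1 then B1 j i else 0
      else if i < m1 then 0 else B2 (j - k1) (i - m1))" for j i
  have "X \<inter> Y = cone_system (m1 + m2) (k1 + k2) a A B c"
  proof (intro set_eqI iffI)
    fix x assume "x \<in> X \<inter> Y"
    then obtain w1 w2 where
      "\<forall>j<k1. A1 j x + (\<Sum>i<m1. w1 i *\<^sub>R B1 j i) + c1 j \<in> power_cone (a1 j)"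
      "\<forall>j<k2. A2 j x + (\<Sum>i<m2. w2 i *\<^sub>R B2 j i) + c2 j \<in> power_cone (a2 j)"
      unfolding X Y cone_system_def by blast
    then show "x \<in> cone_system (m1 + m2) (k1 + k2) a A B c"
      unfolding cone_system_def mem_Collect_eq
      by (intro exI[of _ "\<lambda>i. if i < m1 then w1 i else w2 (i - m1)"])
        (simp add: all_less_add sum_lessThan_add a_def A_def B_def c_def)
  next
    fix x assume "x \<in> cone_system (m1 + m2) (k1 + k2) a A B c"
    then obtain w where
      "\<forall>j<k1 + k2. A j x + (\<Sum>i<m1 + m2. w i *\<^sub>R B j i) + c j \<in> power_cone (a j)"
      unfolding cone_system_def by blast
    then have 1:
      "\<forall>j<k1. A1 j x + (\<Sum>i<m1. w i *\<^sub>R B1 j i) + c1 j \<in> power_cone (a1 j)" and 2: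
      "\<forall>j<k2. A2 j x + (\<Sum>i<m2. w (m1 + i) *\<^sub>R B2 j i) + c2 j \<in> power_cone (a2 j)"
      by (simp_all add: all_less_add sum_lessThan_add a_def A_def B_def c_def)
    show "x \<in> X \<inter> Y"
      unfolding X Y cone_system_def Int_iff mem_Collect_eq
      by (rule conjI, rule exI[of _ w], rule 1, rule exI[of _ "\<lambda>i. w (m1 + i)"], rule 2)
  qed
  moreover have "\<forall>j<k1 + k2. a j \<in> {0..1} \<and> linear (A j)"
    using 1 2 by (simp add: all_less_add a_def A_def)
  ultimately show ?thesis
    using power_cone_representable_cone_system by simp
qed

lemma power_cone_representable_affine_vimage:
  assumes "power_cone_representable Y" "linear f"
  shows "power_cone_representable {x. f x + d \<in> Y}"
proof -
  from assms obtain m k a A B c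
    where *: "\<forall>j<k. a j \<in> {0..1} \<and> linear (A j)" and Y: "Y = cone_system m k a A B c"
    unfolding power_cone_representable_iff by blast
  have eq: "A j (f x + d) + (\<Sum>i<m. w i *\<^sub>R B j i) + c j
      = (A j \<circ> f) x + (\<Sum>i<m. w i *\<^sub>R B j i) + (A j d + c j)" if "j < k" for j x w
    using * that by (simp add: linear_add)
  have "{x. f x + d \<in> Y} = cone_system m k a (\<lambda>j. A j \<circ> f) B (\<lambda>j. A j d + c j)"
    by (simp only: Y cone_system_def eq mem_Collect_eq cong: imp_cong)
  then show ?thesis
    using * power_cone_representable_cone_system[of k a "\<lambda>j. A j \<circ> f"] \<open>linear f\<close>
    by (simp add: linear_compose)
qed

text \<open>The quantifier over \<open>w\<close> already expresses a projection, so the coordinates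
  of the component to be removed simply become further auxiliary variables.\<close>

lemma power_cone_representable_fst_image:
  fixes Z :: "('a::euclidean_space \<times> 'b::euclidean_space) set"
  assumes "power_cone_representable Z"
  shows "power_cone_representable (fst ` Z)"
proof -
  from assms obtain m k a A B c
    where *: "\<forall>j<k. a j \<in> {0..1} \<and> linear (A j)" and Z: "Z = cone_system m k a A B c"
    unfolding power_cone_representable_iff by blast
  define n where "n = DIM('b)"
  obtain e where e: "bij_betw e {..<n} (Basis :: 'b set)"
    unfolding n_def using ex_bij_betw_nat_finite[OF finite_Basis] by (metis atLeast0LessThan)
  \<comment> \<open>The \<open>n\<close> new columns are the images of the basis vectors of the
    second factor.\<close>
  define B' where "B' j i = (if i < m then B j i else A j (0, e (i - m)))" for j i
  have split: "A j (x, y) = A j (x, 0) + A j (0, y)" if "j < k" for j x y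
    using * that linear_add[of "A j" "(x, 0)" "(0, y)"] by simp
  have comb: "A j (0, \<Sum>i<n. w i *\<^sub>R e i) = (\<Sum>i<n. w i *\<^sub>R A j (0, e i))" if "j < k" for j w
  proof -
    have "linear (\<lambda>y. A j (0, y))"
    proof -
      have "linear (\<lambda>y::'b. (0::'a, y))" by (simp add: linear_iff)
      from linear_compose[OF this, of "A j"] show ?thesis using * that by (simp add: o_def)
    qed
    from linear_sum[OF this, of "\<lambda>i. w i *\<^sub>R e i" "{..<n}"] linear_scale[OF this]
    show ?thesis by simp
  qed
  have "fst ` Z = cone_system (m + n) k a (\<lambda>j x. A j (x, 0)) B' c"
  proof (intro set_eqI iffI)
    fix x assume "x \<in> fst ` Z"
    then obtain y w where w: "\<forall>j<k. A j (x, y) + (\<Sum>i<m. w i *\<^sub>R B j i) + c j \<in> power_cone (a j)"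
      unfolding Z cone_system_def by auto
    have "y = (\<Sum>b\<in>Basis. (y \<bullet> b) *\<^sub>R b)" by (simp add: euclidean_representation)
    also have "\<dots> = (\<Sum>i<n. (y \<bullet> e i) *\<^sub>R e i)"
      by (rule sum.reindex_bij_betw[OF e, symmetric])
    finally have y: "y = (\<Sum>i<n. (y \<bullet> e i) *\<^sub>R e i)" .
    have "A j (0, y) = (\<Sum>i<n. (y \<bullet> e i) *\<^sub>R A j (0, e i))" if "j < k" for j
      using comb[OF that, of "\<lambda>i. y \<bullet> e i"] y by simp
    then show "x \<in> cone_system (m + n) k a (\<lambda>j x. A j (x, 0)) B' c"
      unfolding cone_system_def mem_Collect_eq using w
      by (intro exI[of _ "\<lambda>i. if i < m then w i else y \<bullet> e (i - m)"])
        (simp add: sum_lessThan_add B'_def split[of _ x y] algebra_simps)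
  next
    fix x assume "x \<in> cone_system (m + n) k a (\<lambda>j x. A j (x, 0)) B' c"
    then obtain w where
      w: "\<forall>j<k. A j (x, 0) + (\<Sum>i<m + n. w i *\<^sub>R B' j i) + c j \<in> power_cone (a j)"
      unfolding cone_system_def by blast
    define y where "y = (\<Sum>i<n. w (m + i) *\<^sub>R e i)"
    have "A j (0, y) = (\<Sum>i<n. w (m + i) *\<^sub>R A j (0, e i))" if "j < k" for j
      unfolding y_def using comb[OF that] by simp
    then have "(x, y) \<in> Z"
      unfolding Z cone_system_def mem_Collect_eq using w
      by (intro exI[of _ w]) (simp add: sum_lessThan_add B'_def split[of _ x y] algebra_simps)
    then show "x \<in> fst ` Z" by force
  qed
  moreover have "linear (\<lambda>x. A j (x, 0))" if "j < k" for j
  proof -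
    have "linear (\<lambda>x::'a. (x, 0::'b))" by (simp add: linear_iff)
    from linear_compose[OF this, of "A j"] show ?thesis using * that by (simp add: o_def)
  qed
  ultimately show ?thesis
    using * power_cone_representable_cone_system[of k a "\<lambda>j x. A j (x, 0)"] by simp
qed

section \<open>Linear inequalities and equations\<close>

lemma power_cone_representable_ge:
  fixes f :: "'a::euclidean_space \<Rightarrow> real"
  assumes "linear f"
  shows "power_cone_representable {x. d \<le> f x}"
proof -
  \<comment> \<open>Exponent 1 with the last two coordinates fixed to 0 leaves only the sign
    condition on the first coordinate.\<close>
  have "linear (\<lambda>x. (f x, 0::real, 0::real))"
    using assms by (simp add: linear_iff)
  from power_cone_representable_power_cone[OF _ this, of 1 "(- d, 0, 0)"] show ?thesis
    by (simp add: power_cone_def rpow_def)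
qed

lemma power_cone_representable_eq:
  fixes f :: "'a::euclidean_space \<Rightarrow> real"
  assumes "linear f"
  shows "power_cone_representable {x. f x = d}"
proof -
  have eq: "{x. f x = d} = {x. d \<le> f x} \<inter> {x. - d \<le> - f x}"
    by (rule set_eqI, unfold mem_Collect_eq Int_iff, linarith)
  show ?thesis
    unfolding eq using assms
    by (intro power_cone_representable_Int power_cone_representable_ge linear_compose_neg[OF assms])
qed

section \<open>Homogenization and convex hulls of unions\<close>

text \<open>Boundedness of \<open>Y\<close> forces the slice at \<open>t = 0\<close> of the homogenized system, which consists of
  recession directions of \<open>Y\<close>, to be trivial.\<close>
lemma power_cone_representable_homogenization:
  fixes Y :: "'a::euclidean_space set"
  assumes Y: "power_cone_representable Y" and bdd: "bounded Y" and ne: "Y \<noteq> {}"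
  shows "power_cone_representable {(x, t). 0 \<le> t \<and> x \<in> (*\<^sub>R) t ` Y}"
proof -
  from Y obtain m k a A B c
    where *: "\<forall>j<k. a j \<in> {0..1} \<and> linear (A j)" and Y: "Y = cone_system m k a A B c"
    unfolding power_cone_representable_iff by blast
  \<comment> \<open>Multiplying the offset by \<open>t\<close> makes the system homogeneous in
    \<open>x\<close>, \<open>t\<close> and the auxiliary variables jointly.\<close>
  define A' where "A' j = (\<lambda>(x, t). A j x + t *\<^sub>R c j)" for j
  have A': "linear (A' j)" if "j < k" for j
    using * that by (intro linearI) (auto simp: A'_def linear_add linear_scale scaleR_add_left scaleR_add_right)
  define C where "C = cone_system m k a A' B (\<lambda>_. 0)"
  \<comment> \<open>For positive \<open>t\<close> the witnesses on the two sides differ by the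
    factor \<open>t\<close>, and the cones are invariant under this scaling.\<close>
  have pos: "(x, t) \<in> C \<longleftrightarrow> x /\<^sub>R t \<in> Y" if t: "0 < t" for x t
  proof
    assume "(x, t) \<in> C"
    then obtain w where
      w: "\<And>j. j < k \<Longrightarrow> A j x + t *\<^sub>R c j + (\<Sum>i<m. w i *\<^sub>R B j i) \<in> power_cone (a j)"
      unfolding C_def cone_system_def A'_def by auto
    have "A j (x /\<^sub>R t) + (\<Sum>i<m. (w i / t) *\<^sub>R B j i) + c j \<in> power_cone (a j)" if j: "j < k" for j
    proof -
      have eq: "inverse t *\<^sub>R (A j x + t *\<^sub>R c j + (\<Sum>i<m. w i *\<^sub>R B j i))
        = A j (x /\<^sub>R t) + (\<Sum>i<m. (w i / t) *\<^sub>R B j i) + c j"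
        using * j t by (simp add: linear_scale scaleR_add_right scaleR_sum_right divide_inverse mult_ac)
      show ?thesis
        unfolding eq[symmetric] using * j t by (intro power_cone_scaleR w) auto
    qed
    then show "x /\<^sub>R t \<in> Y"
      unfolding Y cone_system_def mem_Collect_eq
      by (intro exI[of _ "\<lambda>i. w i / t"] allI impI)
  next
    assume "x /\<^sub>R t \<in> Y"
    then obtain w where
      w: "\<And>j. j < k \<Longrightarrow> A j (x /\<^sub>R t) + (\<Sum>i<m. w i *\<^sub>R B j i) + c j \<in> power_cone (a j)"
      unfolding Y cone_system_def by blast
    have "A' j (x, t) + (\<Sum>i<m. (t * w i) *\<^sub>R B j i) + 0 \<in> power_cone (a j)" if j: "j < k" for j
    proof -
      have eq: "t *\<^sub>R (A j (x /\<^sub>R t) + (\<Sum>i<m. w i *\<^sub>R B j i) + c j)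
        = A' j (x, t) + (\<Sum>i<m. (t * w i) *\<^sub>R B j i) + 0"
        using * j t by (simp add: A'_def linear_scale scaleR_add_right scaleR_sum_right)
      show ?thesis
        unfolding eq[symmetric] using * j t by (intro power_cone_scaleR w) auto
    qed
    then show "(x, t) \<in> C"
      unfolding C_def cone_system_def mem_Collect_eq
      by (intro exI[of _ "\<lambda>i. t * w i"] allI impI)
  qed
  have zero: "(x, 0) \<in> C \<longleftrightarrow> x = 0" for x
  proof
    assume "(x, 0) \<in> C"
    then obtain w where
      w: "\<And>j. j < k \<Longrightarrow> A j x + (\<Sum>i<m. w i *\<^sub>R B j i) \<in> power_cone (a j)"
      unfolding C_def cone_system_def A'_def by auto
    obtain y where "y \<in> Y" using ne by blast
    then obtain v where
      v: "\<And>j. j < k \<Longrightarrow> A j y + (\<Sum>i<m. v i *\<^sub>R B j i) + c j \<in> power_cone (a j)"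
      unfolding Y cone_system_def by blast
    \<comment> \<open>Adding nonnegative multiples of a solution of the offset-free system to a
      solution for \<open>y\<close> stays in every cone.\<close>
    have ray: "y + s *\<^sub>R x \<in> Y" if s: "0 \<le> s" for s
    proof -
      have "A j (y + s *\<^sub>R x) + (\<Sum>i<m. (v i + s * w i) *\<^sub>R B j i) + c j \<in> power_cone (a j)"
        if j: "j < k" for j
      proof -
        have eq: "A j y + (\<Sum>i<m. v i *\<^sub>R B j i) + c j + s *\<^sub>R (A j x + (\<Sum>i<m. w i *\<^sub>R B j i))
          = A j (y + s *\<^sub>R x) + (\<Sum>i<m. (v i + s * w i) *\<^sub>R B j i) + c j"
          using * j by (simp add: linear_add linear_scale scaleR_add_right scaleR_add_left
              scaleR_sum_right sum.distrib)
        show ?thesis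
          unfolding eq[symmetric] using * j s
          by (intro power_cone_add power_cone_scaleR v w) auto
      qed
      then show ?thesis
        unfolding Y cone_system_def mem_Collect_eq
        by (intro exI[of _ "\<lambda>i. v i + s * w i"] allI impI)
    qed
    obtain M where M: "\<And>z. z \<in> Y \<Longrightarrow> norm z \<le> M" using bdd by (auto simp: bounded_iff)
    show "x = 0"
    proof (rule ccontr)
      assume "x \<noteq> 0"
      \<comment> \<open>With this length \<open>s *\<^sub>R x\<close> has norm
        \<open>M + norm y + 1\<close>, so by the triangle inequality the point
        \<open>y + s *\<^sub>R x\<close> violates the bound \<open>M\<close>.\<close>
      define s where "s = (M + norm y + 1) / norm x"
      have "0 \<le> M" using M[OF \<open>y \<in> Y\<close>] norm_ge_zero order_trans by blast
      then have s: "0 \<le> s" by (simp add: s_def)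
      have "norm (s *\<^sub>R x) = M + norm y + 1"
        using \<open>x \<noteq> 0\<close> \<open>0 \<le> M\<close> by (simp add: s_def)
      moreover have "norm (s *\<^sub>R x) \<le> norm (y + s *\<^sub>R x) + norm y"
        using norm_triangle_ineq4[of "y + s *\<^sub>R x" y] by simp
      ultimately show False using M[OF ray[OF s]] by linarith
    qed
  next
    assume "x = 0"
    then have "A' j (x, 0) = 0" if "j < k" for j
      using * that by (simp add: A'_def linear_0)
    then show "(x, 0) \<in> C"
      unfolding C_def cone_system_def mem_Collect_eq
      by (intro exI[of _ "\<lambda>_. 0"]) (simp add: power_cone_zero)
  qed
  \<comment> \<open>The extra constraint excludes negative \<open>t\<close>; at \<open>t = 0\<close>
    scaling the nonempty set \<open>Y\<close> yields exactly the origin, in agreement with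
    \<open>zero\<close>.\<close>
  have "(x, t) \<in> C \<inter> {z. 0 \<le> snd z} \<longleftrightarrow> 0 \<le> t \<and> x \<in> (*\<^sub>R) t ` Y" for x t
  proof (cases "0 < t")
    case True
    then have "x /\<^sub>R t \<in> Y \<longleftrightarrow> x \<in> (*\<^sub>R) t ` Y"
      by (auto intro!: image_eqI[of _ _ "x /\<^sub>R t"])
    with True show ?thesis by (simp add: pos)
  next
    case False
    then show ?thesis using ne by (cases "t = 0") (auto simp: zero)
  qed
  then have "{(x, t). 0 \<le> t \<and> x \<in> (*\<^sub>R) t ` Y} = C \<inter> {z. 0 \<le> snd z}"
    by (simp add: set_eq_iff)
  moreover have "power_cone_representable C"
    unfolding C_def using * A' by (intro power_cone_representable_cone_system) blast
  ultimately show ?thesis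
    by (simp add: power_cone_representable_Int power_cone_representable_ge linear_snd)
qed

text \<open>The bilinear products in a convex combination disappear once the scaled point is itself
  a variable: the point of \<open>X\<close> and its weight enter only through the cone over
  \<open>X\<close>, the rest through the cone over \<open>Y\<close>.\<close>

lemma power_cone_representable_convex_hull_Un:
  fixes X Y :: "'a::euclidean_space set"
  assumes X: "power_cone_representable X" "bounded X"
    and Y: "power_cone_representable Y" "bounded Y"
  shows "power_cone_representable (convex hull (X \<union> Y))"
proof (cases "X = {} \<or> Y = {}")
  case True
  then show ?thesis
    using X Y by (auto simp: hull_same power_cone_representable_imp_convex)
next
  case False
  define CX where "CX = {(x, t). 0 \<le> t \<and> x \<in> (*\<^sub>R) t ` X}"
  define CY where "CY = {(x, t). 0 \<le> t \<and> x \<in> (*\<^sub>R) t ` Y}"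
  \<comment> \<open>In a triple \<open>(z, x, t)\<close>, \<open>f\<close> extracts the weighted
    part coming from \<open>X\<close>, and \<open>g\<close> shifted by \<open>(0, 1)\<close> the
    remainder with weight \<open>1 - t\<close>.\<close>
  define f :: "'a \<times> 'a \<times> real \<Rightarrow> 'a \<times> real" where "f = (\<lambda>(z, x, t). (x, t))"
  define g :: "'a \<times> 'a \<times> real \<Rightarrow> 'a \<times> real" where "g = (\<lambda>(z, x, t). (z - x, - t))"
  have fg: "linear f" "linear g"
    by (auto simp: f_def g_def linear_iff algebra_simps)
  have "convex hull (X \<union> Y) = fst ` ({p. f p + 0 \<in> CX} \<inter> {p. g p + (0, 1) \<in> CY})"
  proof (intro set_eqI iffI)
    fix z assume "z \<in> convex hull (X \<union> Y)"
    then obtain u v x y where uv: "0 \<le> u" "0 \<le> v" "u + v = 1" and xy: "x \<in> X" "y \<in> Y"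
      and z: "z = u *\<^sub>R x + v *\<^sub>R y"
      using False convex_hull_union_two[of X Y] X(1) Y(1)
      by (auto simp: power_cone_representable_imp_convex)
    from uv have "v = 1 - u" by simp
    with uv xy have "(z, u *\<^sub>R x, u) \<in> {p. f p + 0 \<in> CX} \<inter> {p. g p + (0, 1) \<in> CY}"
      by (auto simp: f_def g_def CX_def CY_def z)
    then show "z \<in> fst ` ({p. f p + 0 \<in> CX} \<inter> {p. g p + (0, 1) \<in> CY})"
      by (metis fst_conv image_eqI)
  next
    fix z assume "z \<in> fst ` ({p. f p + 0 \<in> CX} \<inter> {p. g p + (0, 1) \<in> CY})"
    then obtain u x y where u: "0 \<le> u" "0 \<le> 1 - u" and xy: "x \<in> X" "y \<in> Y"
      and z: "z - u *\<^sub>R x = (1 - u) *\<^sub>R y"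
      by (auto simp: f_def g_def CX_def CY_def)
    have "z = u *\<^sub>R x + (1 - u) *\<^sub>R y" using z by (metis add.commute diff_add_cancel)
    moreover have "x \<in> convex hull (X \<union> Y)" "y \<in> convex hull (X \<union> Y)"
      using xy by (simp_all add: hull_inc)
    ultimately show "z \<in> convex hull (X \<union> Y)"
      using u convexD[OF convex_convex_hull, of x "X \<union> Y" y u "1 - u"] by simp
  qed
  moreover have "power_cone_representable CX" "power_cone_representable CY"
    unfolding CX_def CY_def
    using X Y False by (simp_all add: power_cone_representable_homogenization)
  ultimately show ?thesis
    using fg by (simp only: power_cone_representable_fst_image power_cone_representable_Int
        power_cone_representable_affine_vimage)
qed

section \<open>Introduction rules for sets given by affine and conic conditions\<close>

lemma power_cone_representable_conj:
  "power_cone_representable {x. P x} \<Longrightarrow> power_cone_representable {x. Q x} \<Longrightarrow>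
    power_cone_representable {x. P x \<and> Q x}"
  using power_cone_representable_Int[of "{x. P x}" "{x. Q x}"] by (simp add: Collect_conj_eq)

text \<open>Affinity of \<open>f\<close> is expressed as linearity of \<open>f x - f 0\<close>, so
  that a concrete condition matches without its constant being split off first.\<close>

lemma power_cone_representable_affine_mem:
  assumes "a \<in> {0..1}" "linear (\<lambda>x. f x - f 0)"
  shows "power_cone_representable {x. f x \<in> power_cone a}"
  using power_cone_representable_power_cone[OF assms, of "f 0"] by simp

lemma power_cone_representable_affine_le:
  fixes f g :: "'a::euclidean_space \<Rightarrow> real"
  assumes "linear (\<lambda>x. (g x - g 0) - (f x - f 0))"
  shows "power_cone_representable {x. f x \<le> g x}"
  using power_cone_representable_ge[OF assms, of "f 0 - g 0"] by (simp add: algebra_simps)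

lemma power_cone_representable_affine_eq:
  fixes f g :: "'a::euclidean_space \<Rightarrow> real"
  assumes "linear (\<lambda>x. (g x - g 0) - (f x - f 0))"
  shows "power_cone_representable {x. f x = g x}"
proof -
  have "(g x - g 0) - (f x - f 0) = f 0 - g 0 \<longleftrightarrow> f x = g x" for x by linarith
  then show ?thesis
    using power_cone_representable_eq[OF assms, of "f 0 - g 0"] by simp
qed

lemmas power_cone_representable_intros =
  power_cone_representable_conj power_cone_representable_affine_mem
  power_cone_representable_affine_le power_cone_representable_affine_eq

text \<open>The hull of the remaining sets is again bounded and representable, and nested hulls
  collapse, so the binary case can be iterated.\<close>

lemma power_cone_representable_convex_hull_Union:
  fixes \<X> :: "'a::euclidean_space set set"
  assumes "finite \<X>" "\<And>X. X \<in> \<X> \<Longrightarrow> power_cone_representable X" "\<And>X. X \<in> \<X> \<Longrightarrow> bounded X"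
  shows "power_cone_representable (convex hull \<Union>\<X>)"
  using assms
proof (induction \<X> rule: finite_induct)
  case empty
  \<comment> \<open>The empty set is represented by an infeasible constraint.\<close>
  have "power_cone_representable {x::'a. (1::real) \<le> 0}"
    by (rule power_cone_representable_affine_le) (simp add: linear_zero)
  then show ?case by simp
next
  case (insert X \<X>)
  have "bounded (convex hull \<Union>\<X>)"
    using insert by (intro bounded_convex_hull bounded_Union) auto
  then have "power_cone_representable (convex hull (X \<union> convex hull \<Union>\<X>))"
    using insert by (intro power_cone_representable_convex_hull_Un) auto
  then show ?case by (simp flip: hull_Un_right)
qed

section \<open>Concavity and convexity of real powers\<close>

lemma powr_concave: "concave_on {0<..} (\<lambda>x. x powr k)" if "0 \<le> k" "k \<le> 1" for k :: real
proof (rule f''_le0_imp_concave)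
  show "convex {0::real<..}" by (rule convex_real_interval)
  show "((\<lambda>x. x powr k) has_real_derivative k * x powr (k - 1)) (at x)" if "x \<in> {0<..}" for x
    using that by (auto intro!: derivative_eq_intros)
  show "((\<lambda>x. k * x powr (k - 1)) has_real_derivative k * ((k - 1) * x powr (k - 1 - 1))) (at x)"
    if "x \<in> {0<..}" for x
    using that by (auto intro!: derivative_eq_intros)
  show "k * ((k - 1) * x powr (k - 1 - 1)) \<le> 0" for x :: real
    using that by (intro mult_nonneg_nonpos mult_nonpos_nonneg) auto
qed

lemma powr_neg_convex: "convex_on {0<..} (\<lambda>x. x powr k)" if "k \<le> 0" for k :: real
proof (rule f''_ge0_imp_convex)
  show "convex {0::real<..}" by (rule convex_real_interval)
  show "((\<lambda>x. x powr k) has_real_derivative k * x powr (k - 1)) (at x)" if "x \<in> {0<..}" for x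
    using that by (auto intro!: derivative_eq_intros)
  show "((\<lambda>x. k * x powr (k - 1)) has_real_derivative k * ((k - 1) * x powr (k - 1 - 1))) (at x)"
    if "x \<in> {0<..}" for x
    using that by (auto intro!: derivative_eq_intros)
  show "0 \<le> k * ((k - 1) * x powr (k - 1 - 1))" for x :: real
    using that by (intro mult_nonpos_nonpos mult_nonpos_nonneg) auto
qed

lemma between_convex_comb:
  fixes x y z :: real
  assumes "x \<le> z" "z \<le> y"
  obtains t where "0 \<le> t" "t \<le> 1" "z = (1 - t) * x + t * y"
proof (cases "x = y")
  case True
  then show ?thesis using assms that[of 0] by simp
next
  case False
  then have xy: "0 < y - x" using assms by simp
  define t where "t = (z - x) / (y - x)"
  have "t * (y - x) = z - x" using xy by (simp add: t_def)
  moreover have "0 \<le> t" "t \<le> 1" using xy assms by (simp_all add: t_def)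
  ultimately show ?thesis by (intro that[of t]) (auto simp: algebra_simps)
qed

section \<open>Sets extended upward or downward in the third coordinate\<close>

lemma power_cone_representable_upward:
  assumes "power_cone_representable (Y :: (real \<times> real \<times> real) set)"
  shows "power_cone_representable {(p, q, z). \<exists>z'\<le>z. (p, q, z') \<in> Y}"
proof -
  \<comment> \<open>The height \<open>z'\<close> is carried as an additional last coordinate, which
    \<open>?f\<close> puts in place of \<open>z\<close> and the projection then eliminates.\<close>
  let ?f = "\<lambda>(x :: (real \<times> real \<times> real) \<times> real). (fst (fst x), fst (snd (fst x)), snd x)"
  have "power_cone_representable {x. ?f x + 0 \<in> Y}"
    using assms by (rule power_cone_representable_affine_vimage) (simp add: linear_iff)
  moreover have "power_cone_representable
      {x :: (real \<times> real \<times> real) \<times> real. snd x \<le> snd (snd (fst x))}"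
    by (rule power_cone_representable_affine_le) (simp add: linear_iff algebra_simps)
  ultimately have "power_cone_representable
      (fst ` {x. ?f x + 0 \<in> Y \<and> snd x \<le> snd (snd (fst x))})"
    by (intro power_cone_representable_fst_image power_cone_representable_conj)
  also have "fst ` {x. ?f x + 0 \<in> Y \<and> snd x \<le> snd (snd (fst x))}
      = {(p, q, z). \<exists>z'\<le>z. (p, q, z') \<in> Y}"
    by (force simp: image_iff)
  finally show ?thesis .
qed

lemma power_cone_representable_downward:
  assumes "power_cone_representable (Y :: (real \<times> real \<times> real) set)"
  shows "power_cone_representable {(p, q, z). \<exists>z'\<ge>z. (p, q, z') \<in> Y}"
proof -
  let ?f = "\<lambda>(x :: (real \<times> real \<times> real) \<times> real). (fst (fst x), fst (snd (fst x)), snd x)"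
  have "power_cone_representable {x. ?f x + 0 \<in> Y}"
    using assms by (rule power_cone_representable_affine_vimage) (simp add: linear_iff)
  moreover have "power_cone_representable
      {x :: (real \<times> real \<times> real) \<times> real. snd (snd (fst x)) \<le> snd x}"
    by (rule power_cone_representable_affine_le) (simp add: linear_iff algebra_simps)
  ultimately have "power_cone_representable
      (fst ` {x. ?f x + 0 \<in> Y \<and> snd (snd (fst x)) \<le> snd x})"
    by (intro power_cone_representable_fst_image power_cone_representable_conj)
  also have "fst ` {x. ?f x + 0 \<in> Y \<and> snd (snd (fst x)) \<le> snd x}
      = {(p, q, z). \<exists>z'\<ge>z. (p, q, z') \<in> Y}"
    by (force simp: image_iff)
  finally show ?thesis .
qed

text \<open>Nonnegative weights preserve the inequality between the heights. This allows
  \<open>hull_minimal\<close> to compare convex hulls with such extended sets.\<close>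

lemma convex_upward:
  assumes "convex (Y :: (real \<times> real \<times> real) set)"
  shows "convex {(p, q, z). \<exists>z'\<le>z. (p, q, z') \<in> Y}"
proof (rule convexI)
  fix x y and u v :: real
  assume uv: "0 \<le> u" "0 \<le> v" "u + v = 1"
    and "x \<in> {(p, q, z). \<exists>z'\<le>z. (p, q, z') \<in> Y}" "y \<in> {(p, q, z). \<exists>z'\<le>z. (p, q, z') \<in> Y}"
  then obtain p q z z' p2 q2 z2 z2' where
    xy: "x = (p, q, z)" "y = (p2, q2, z2)" and le: "z' \<le> z" "z2' \<le> z2"
    and Y: "(p, q, z') \<in> Y" "(p2, q2, z2') \<in> Y" by auto
  have "u * z' + v * z2' \<le> u * z + v * z2"
    using uv le by (intro add_mono mult_left_mono)
  with convexD[OF assms Y uv]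
  show "u *\<^sub>R x + v *\<^sub>R y \<in> {(p, q, z). \<exists>z'\<le>z. (p, q, z') \<in> Y}"
    by (auto simp: xy)
qed

lemma convex_downward:
  assumes "convex (Y :: (real \<times> real \<times> real) set)"
  shows "convex {(p, q, z). \<exists>z'\<ge>z. (p, q, z') \<in> Y}"
proof (rule convexI)
  fix x y and u v :: real
  assume uv: "0 \<le> u" "0 \<le> v" "u + v = 1"
    and "x \<in> {(p, q, z). \<exists>z'\<ge>z. (p, q, z') \<in> Y}" "y \<in> {(p, q, z). \<exists>z'\<ge>z. (p, q, z') \<in> Y}"
  then obtain p q z z' p2 q2 z2 z2' where
    xy: "x = (p, q, z)" "y = (p2, q2, z2)" and le: "z' \<ge> z" "z2' \<ge> z2"
    and Y: "(p, q, z') \<in> Y" "(p2, q2, z2') \<in> Y" by auto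
  have "u * z' + v * z2' \<ge> u * z + v * z2"
    using uv le by (intro add_mono mult_left_mono)
  with convexD[OF assms Y uv]
  show "u *\<^sub>R x + v *\<^sub>R y \<in> {(p, q, z). \<exists>z'\<ge>z. (p, q, z') \<in> Y}"
    by (auto simp: xy)
qed

section \<open>The graph of the compression ratio\<close>

context
  fixes a1 a2 b1 b2 r1 r2 \<kappa> :: real
begin

abbreviation ratio_domain ("\<P>") where "\<P> \<equiv> Pi_ij a1 a2 b1 b2 r1 r2"

definition ratio_graph :: "(real \<times> real \<times> real) set" where
  "ratio_graph = {(p, q, z). (p, q) \<in> \<P> \<and> z = (q / p) powr \<kappa>}"

text \<open>For \<open>0 < \<kappa>\<close> the ratio is convex in \<open>p\<close> along such an
  edge, so its epigraph is taken. The cap, an upper bound of the ratio on the domain, keeps the set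
  bounded, as hulls of unions require.\<close>

definition horizontal_edge :: "real \<Rightarrow> (real \<times> real \<times> real) set" where
  "horizontal_edge c =
    {(p, q, z). (p, q) \<in> \<P> \<and> q = c \<and> (q / p) powr \<kappa> \<le> z \<and> z \<le> r2 powr \<kappa>}"

text \<open>For \<open>0 < \<kappa> < 1\<close> the ratio is concave in \<open>q\<close> here, so
  the hypograph is taken; the floor 0 keeps it bounded.\<close>

definition vertical_edge :: "real \<Rightarrow> (real \<times> real \<times> real) set" where
  "vertical_edge d = {(p, q, z). (p, q) \<in> \<P> \<and> p = d \<and> 0 \<le> z \<and> z \<le> (q / p) powr \<kappa>}"

text \<open>The ratio is constant on this line, so the graph itself is convex and serves from below
  and from above.\<close>

definition oblique_edge :: "real \<Rightarrow> (real \<times> real \<times> real) set" where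
  "oblique_edge r = {(p, q, z). (p, q) \<in> \<P> \<and> q = r * p \<and> z = r powr \<kappa>}"

definition lower_hull :: "(real \<times> real \<times> real) set" where
  "lower_hull = convex hull \<Union>{horizontal_edge b1, horizontal_edge b2, oblique_edge r1, oblique_edge r2}"

definition upper_hull :: "(real \<times> real \<times> real) set" where
  "upper_hull = convex hull \<Union>{vertical_edge a1, vertical_edge a2, oblique_edge r1, oblique_edge r2}"

context
  assumes pos: "0 < a1" "0 < b1" "0 < r1" and \<kappa>: "0 < \<kappa>" "\<kappa> < 1"
begin

text \<open>Positivity of \<open>p\<close> clears the divisions and exhibits the domain as a
  polygon.\<close>

lemma Pi_ij_iff:
  "(p, q) \<in> \<P> \<longleftrightarrow> a1 \<le> p \<and> p \<le> a2 \<and> b1 \<le> q \<and> q \<le> b2 \<and> r1 * p \<le> q \<and> q \<le> r2 * p"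
  using pos by (auto simp: Pi_ij_def field_simps)

lemma ratio_bounds:
  assumes "(p, q) \<in> \<P>"
  shows "0 < p" "0 < q" "0 \<le> (q / p) powr \<kappa>" "(q / p) powr \<kappa> \<le> r2 powr \<kappa>"
  using assms pos \<kappa> by (auto simp: Pi_ij_def intro!: powr_mono2)

lemma oblique_edge_subset: "oblique_edge r \<subseteq> ratio_graph"
  by (auto simp: oblique_edge_def ratio_graph_def dest: ratio_bounds)

section \<open>Boundedness and representability of the edges\<close>

lemma bounded_edges:
  "bounded ratio_graph" "bounded (horizontal_edge c)" "bounded (vertical_edge d)"
  "bounded (oblique_edge r)"
proof -
  let ?B = "{a1..a2} \<times> {b1..b2} \<times> {0..r2 powr \<kappa>}"
  have box: "(p, q, z) \<in> ?B" if "(p, q) \<in> \<P>" "0 \<le> z" "z \<le> r2 powr \<kappa>" for p q z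
    using that by (auto simp: Pi_ij_iff)
  have "bounded ?B"
    by (intro bounded_Times bounded_closed_interval)
  moreover have "ratio_graph \<subseteq> ?B"
  proof
    fix y assume "y \<in> ratio_graph"
    then obtain p q where "y = (p, q, (q / p) powr \<kappa>)" "(p, q) \<in> \<P>"
      by (auto simp: ratio_graph_def)
    then show "y \<in> ?B" using box ratio_bounds(3,4) by blast
  qed
  moreover have "horizontal_edge c \<subseteq> ?B"
  proof
    fix y assume "y \<in> horizontal_edge c"
    then obtain p q z where "y = (p, q, z)" "(p, q) \<in> \<P>" "(q / p) powr \<kappa> \<le> z" "z \<le> r2 powr \<kappa>"
      by (auto simp: horizontal_edge_def)
    then show "y \<in> ?B" using box order_trans[OF powr_ge_zero] by blast
  qed
  moreover have "vertical_edge d \<subseteq> ?B"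
  proof
    fix y assume "y \<in> vertical_edge d"
    then obtain p q z where "y = (p, q, z)" "(p, q) \<in> \<P>" "0 \<le> z" "z \<le> (q / p) powr \<kappa>"
      by (auto simp: vertical_edge_def)
    then show "y \<in> ?B" using box order_trans[OF _ ratio_bounds(4)] by blast
  qed
  ultimately show "bounded ratio_graph" "bounded (horizontal_edge c)" "bounded (vertical_edge d)"
    "bounded (oblique_edge r)"
    using oblique_edge_subset by (meson bounded_subset)+
qed

text \<open>The inequality reads \<open>c powr \<kappa> \<le> p powr \<kappa> * z\<close>. Taking
  the power \<open>1 / (1 + \<kappa>)\<close> normalizes the exponents of \<open>p\<close> and
  \<open>z\<close> to sum 1, as a power cone demands.\<close>

lemma horizontal_edge_cone:
  assumes "0 < p" "0 < c"
  shows "(c / p) powr \<kappa> \<le> z \<longleftrightarrow>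
    (p, z, c powr (\<kappa> / (1 + \<kappa>))) \<in> power_cone (\<kappa> / (1 + \<kappa>))" (is "?l \<longleftrightarrow> ?r")
proof (cases "0 < z")
  case True
  define \<alpha> where "\<alpha> = \<kappa> / (1 + \<kappa>)"
  have \<alpha>: "0 < \<alpha>" "\<alpha> < 1" "1 - \<alpha> = 1 / (1 + \<kappa>)" "\<alpha> * (1 + \<kappa>) = \<kappa>" "(1 - \<alpha>) * (1 + \<kappa>) = 1"
    using \<kappa> by (auto simp: \<alpha>_def field_simps)
  have "?r \<longleftrightarrow> c powr \<alpha> \<le> p powr \<alpha> * z powr (1 - \<alpha>)"
    using assms True \<alpha> by (simp add: power_cone_def rpow_def flip: \<alpha>_def)
  \<comment> \<open>A positive power is strictly increasing on nonnegative bases, so it can be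
    applied in both directions.\<close>
  also have "\<dots> \<longleftrightarrow> (c powr \<alpha>) powr (1 + \<kappa>) \<le> (p powr \<alpha> * z powr (1 - \<alpha>)) powr (1 + \<kappa>)"
    using \<kappa> powr_mono2[of "1 + \<kappa>" "c powr \<alpha>" "p powr \<alpha> * z powr (1 - \<alpha>)"]
      powr_less_mono2[of "1 + \<kappa>" "p powr \<alpha> * z powr (1 - \<alpha>)" "c powr \<alpha>"]
    by (metis add_pos_pos less_imp_le linorder_not_less mult_nonneg_nonneg powr_ge_zero zero_less_one)
  also have "\<dots> \<longleftrightarrow> c powr \<kappa> \<le> p powr \<kappa> * z"
    using True assms \<kappa> by (simp add: powr_mult powr_powr \<alpha> add_nonneg_eq_0_iff)
  also have "\<dots> \<longleftrightarrow> ?l"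
    using assms by (simp add: powr_divide pos_divide_le_eq mult.commute)
  finally show ?thesis ..
next
  case False
  \<comment> \<open>Both sides fail for \<open>z \<le> 0\<close>: a negative \<open>z\<close> is not
    a cone coordinate, and at \<open>z = 0\<close> the product vanishes while the third coordinate
    is positive.\<close>
  have "0 < (c / p) powr \<kappa>" using assms by simp
  then have "\<not> (c / p) powr \<kappa> \<le> z" using False by linarith
  then show ?thesis
    using assms False \<kappa> by (cases "z = 0") (auto simp: power_cone_def rpow_def)
qed

text \<open>Freezing the second coordinate at 1 leaves a pure power of the first; the sign of
  \<open>z\<close> removes the absolute value.\<close>

lemma vertical_edge_cone:
  assumes "0 \<le> z" "0 < q" "0 < d"
  shows "z \<le> (q / d) powr \<kappa> \<longleftrightarrow> (q / d, 1, z) \<in> power_cone \<kappa>"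
  using assms \<kappa> by (simp add: power_cone_def rpow_def)

lemma power_cone_representable_horizontal_edge:
  assumes "0 < c"
  shows "power_cone_representable (horizontal_edge c)"
proof -
  have "horizontal_edge c = {x. a1 \<le> fst x \<and> fst x \<le> a2 \<and> b1 \<le> fst (snd x) \<and> fst (snd x) \<le> b2 \<and>
      r1 * fst x \<le> fst (snd x) \<and> fst (snd x) \<le> r2 * fst x \<and> fst (snd x) = c \<and>
      (fst x, snd (snd x), c powr (\<kappa> / (1 + \<kappa>))) \<in> power_cone (\<kappa> / (1 + \<kappa>)) \<and>
      snd (snd x) \<le> r2 powr \<kappa>}" (is "_ = ?S")
    using pos assms horizontal_edge_cone by (auto simp: horizontal_edge_def Pi_ij_iff)
  moreover have "power_cone_representable ?S"
    using \<kappa> by (intro power_cone_representable_intros) (simp_all add: linear_iff algebra_simps)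
  ultimately show ?thesis by simp
qed

lemma power_cone_representable_vertical_edge:
  assumes "0 < d"
  shows "power_cone_representable (vertical_edge d)"
proof -
  have "vertical_edge d = {x. a1 \<le> fst x \<and> fst x \<le> a2 \<and> b1 \<le> fst (snd x) \<and> fst (snd x) \<le> b2 \<and>
      r1 * fst x \<le> fst (snd x) \<and> fst (snd x) \<le> r2 * fst x \<and> fst x = d \<and> 0 \<le> snd (snd x) \<and>
      (fst (snd x) / d, 1, snd (snd x)) \<in> power_cone \<kappa>}" (is "_ = ?S")
    using pos assms vertical_edge_cone by (auto simp: vertical_edge_def Pi_ij_iff)
  moreover have "power_cone_representable ?S"
    using \<kappa> by (intro power_cone_representable_intros)
      (simp_all add: linear_iff algebra_simps add_divide_distrib)
  ultimately show ?thesis by simp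
qed

lemma power_cone_representable_oblique_edge: "power_cone_representable (oblique_edge r)"
proof -
  have "oblique_edge r = {x. a1 \<le> fst x \<and> fst x \<le> a2 \<and> b1 \<le> fst (snd x) \<and> fst (snd x) \<le> b2 \<and>
      r1 * fst x \<le> fst (snd x) \<and> fst (snd x) \<le> r2 * fst x \<and> fst (snd x) = r * fst x \<and>
      snd (snd x) = r powr \<kappa>}" (is "_ = ?S")
    by (auto simp: oblique_edge_def Pi_ij_iff)
  moreover have "power_cone_representable ?S"
    by (intro power_cone_representable_intros) (simp_all add: linear_iff algebra_simps)
  ultimately show ?thesis by simp
qed

lemma power_cone_representable_lower_hull:
  assumes "b1 \<le> b2"
  shows "power_cone_representable lower_hull"
  unfolding lower_hull_def using pos assms bounded_edges
    power_cone_representable_horizontal_edge power_cone_representable_oblique_edge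
  by (intro power_cone_representable_convex_hull_Union) auto

lemma power_cone_representable_upper_hull:
  assumes "a1 \<le> a2"
  shows "power_cone_representable upper_hull"
  unfolding upper_hull_def using pos assms bounded_edges
    power_cone_representable_vertical_edge power_cone_representable_oblique_edge
  by (intro power_cone_representable_convex_hull_Union) auto

section \<open>The hull of the graph between the lower and the upper hull\<close>

lemma mem_lower_hull:
  "x \<in> horizontal_edge b1 \<union> oblique_edge r1 \<union> (horizontal_edge b2 \<union> oblique_edge r2) \<Longrightarrow>
    x \<in> lower_hull"
  unfolding lower_hull_def by (rule hull_inc) auto

lemma mem_upper_hull:
  "x \<in> vertical_edge a1 \<union> oblique_edge r2 \<union> (vertical_edge a2 \<union> oblique_edge r1) \<Longrightarrow>
    x \<in> upper_hull"
  unfolding upper_hull_def by (rule hull_inc) auto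

text \<open>For fixed \<open>p\<close> the ratio is concave in \<open>q\<close>, so it dominates the chord between the two end
  points of the section of \<open>\<P>\<close> at \<open>p\<close>, which lie on horizontal or oblique edges.\<close>
lemma lower_hull_below_ratio:
  assumes pq: "(p, q) \<in> \<P>"
  shows "\<exists>z\<le>(q / p) powr \<kappa>. (p, q, z) \<in> lower_hull"
proof -
  \<comment> \<open>The end points of the section: at fixed \<open>p\<close>, two constraints bound
    \<open>q\<close> from below and two from above.\<close>
  define l u where "l = max b1 (r1 * p)" and "u = min b2 (r2 * p)"
  have lu: "l \<le> q" "q \<le> u" using pq by (auto simp: l_def u_def Pi_ij_iff)
  have in\<P>: "(p, l) \<in> \<P>" "(p, u) \<in> \<P>" using pq by (auto simp: l_def u_def Pi_ij_iff)
  have p: "0 < p" and lu0: "0 < l" "0 < u" using ratio_bounds[OF in\<P>(1)] ratio_bounds[OF in\<P>(2)] by auto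
  \<comment> \<open>The constraint that attains the maximum decides whether this end lies on a
    horizontal or an oblique edge.\<close>
  have "(p, l, (l / p) powr \<kappa>) \<in> horizontal_edge b1 \<union> oblique_edge r1"
    using in\<P>(1) ratio_bounds[OF in\<P>(1)]
    by (auto simp: horizontal_edge_def oblique_edge_def l_def max_def split: if_splits)
  then have L: "(p, l, (l / p) powr \<kappa>) \<in> lower_hull" by (intro mem_lower_hull) blast
  have "(p, u, (u / p) powr \<kappa>) \<in> horizontal_edge b2 \<union> oblique_edge r2"
    using in\<P>(2) ratio_bounds[OF in\<P>(2)]
    by (auto simp: horizontal_edge_def oblique_edge_def u_def min_def split: if_splits)
  then have U: "(p, u, (u / p) powr \<kappa>) \<in> lower_hull" by (intro mem_lower_hull) blast
  obtain t where t: "0 \<le> t" "t \<le> 1" and q: "q = (1 - t) * l + t * u"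
    using between_convex_comb[OF lu] .
  have "(1 - t) *\<^sub>R (p, l, (l / p) powr \<kappa>) + t *\<^sub>R (p, u, (u / p) powr \<kappa>) \<in> lower_hull"
    using L U t unfolding lower_hull_def by (intro convexD convex_convex_hull) auto
  then have "(p, q, (1 - t) * (l / p) powr \<kappa> + t * (u / p) powr \<kappa>) \<in> lower_hull"
    by (simp add: q algebra_simps)
  moreover have "(1 - t) * (l / p) powr \<kappa> + t * (u / p) powr \<kappa> \<le> (q / p) powr \<kappa>"
  proof -
    have "concave_on {0<..} (\<lambda>x. x powr \<kappa>)" using \<kappa> by (intro powr_concave) auto
    from concave_onD[OF this t, of "l / p" "u / p"] show ?thesis
      using p lu0 by (simp add: q add_divide_distrib)
  qed
  ultimately show ?thesis by blast
qed

text \<open>Symmetrically, the ratio is convex in \<open>p\<close> for fixed \<open>q\<close>.\<close>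
lemma upper_hull_above_ratio:
  assumes pq: "(p, q) \<in> \<P>"
  shows "\<exists>z\<ge>(q / p) powr \<kappa>. (p, q, z) \<in> upper_hull"
proof -
  have r2: "0 < r2" using pq pos by (auto simp: Pi_ij_def)
  \<comment> \<open>Solving \<open>r1 * p \<le> q \<le> r2 * p\<close> for \<open>p\<close> reverses
    the roles: \<open>r2\<close> bounds the left end and \<open>r1\<close> the right end.\<close>
  define l u where "l = max a1 (q / r2)" and "u = min a2 (q / r1)"
  have lu: "l \<le> p" "p \<le> u" using pq pos r2 by (auto simp: l_def u_def Pi_ij_iff field_simps)
  \<comment> \<open>Moving left from \<open>p\<close> preserves the constraint with
    \<open>r1\<close>; the one with \<open>r2\<close> holds by the choice of
    \<open>l\<close>.\<close>
  have in\<P>: "(l, q) \<in> \<P>"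
  proof -
    have "r1 * l \<le> r1 * p" using lu pos by (intro mult_left_mono) auto
    moreover have "q \<le> r2 * l" using r2 by (auto simp: l_def max_def field_simps)
    ultimately show ?thesis using pq lu by (auto simp: Pi_ij_iff l_def)
  qed
  have in\<P>': "(u, q) \<in> \<P>"
  proof -
    have "r2 * p \<le> r2 * u" using lu r2 by (intro mult_left_mono) auto
    moreover have "r1 * u \<le> q" using pos by (auto simp: u_def min_def field_simps)
    ultimately show ?thesis using pq lu by (auto simp: Pi_ij_iff u_def)
  qed
  have q: "0 < q" and lu0: "0 < l" "0 < u" using ratio_bounds[OF in\<P>] ratio_bounds[OF in\<P>'] by auto
  have "(l, q, (q / l) powr \<kappa>) \<in> vertical_edge a1 \<union> oblique_edge r2"
    using in\<P> ratio_bounds[OF in\<P>] r2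
    by (auto simp: vertical_edge_def oblique_edge_def l_def max_def split: if_splits)
  then have L: "(l, q, (q / l) powr \<kappa>) \<in> upper_hull" by (intro mem_upper_hull) blast
  have "(u, q, (q / u) powr \<kappa>) \<in> vertical_edge a2 \<union> oblique_edge r1"
    using in\<P>' ratio_bounds[OF in\<P>'] pos
    by (auto simp: vertical_edge_def oblique_edge_def u_def min_def split: if_splits)
  then have U: "(u, q, (q / u) powr \<kappa>) \<in> upper_hull" by (intro mem_upper_hull) blast
  obtain t where t: "0 \<le> t" "t \<le> 1" and p: "p = (1 - t) * l + t * u"
    using between_convex_comb[OF lu] .
  have "(1 - t) *\<^sub>R (l, q, (q / l) powr \<kappa>) + t *\<^sub>R (u, q, (q / u) powr \<kappa>) \<in> upper_hull"
    using L U t unfolding upper_hull_def by (intro convexD convex_convex_hull) auto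
  then have "(p, q, (1 - t) * (q / l) powr \<kappa> + t * (q / u) powr \<kappa>) \<in> upper_hull"
    by (simp add: p algebra_simps)
  moreover have "(q / p) powr \<kappa> \<le> (1 - t) * (q / l) powr \<kappa> + t * (q / u) powr \<kappa>"
  proof -
    \<comment> \<open>Splitting off the factor \<open>q powr \<kappa>\<close> reduces the claim to
      convexity of a negative power.\<close>
    have ratio: "(q / x) powr \<kappa> = q powr \<kappa> * x powr (- \<kappa>)" if "0 < x" for x
      using that q by (simp add: powr_divide powr_minus_divide)
    have "convex_on {0<..} (\<lambda>x. x powr (- \<kappa>))" using \<kappa> by (intro powr_neg_convex) auto
    from convex_onD[OF this t, of l u]
    have "p powr (- \<kappa>) \<le> (1 - t) * l powr (- \<kappa>) + t * u powr (- \<kappa>)"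
      using lu0 by (simp add: p)
    then have "q powr \<kappa> * p powr (- \<kappa>) \<le> q powr \<kappa> * ((1 - t) * l powr (- \<kappa>) + t * u powr (- \<kappa>))"
      by (intro mult_left_mono) auto
    moreover have "0 < p" using ratio_bounds[OF pq] by simp
    ultimately show ?thesis using lu0 by (simp add: ratio algebra_simps)
  qed
  ultimately show ?thesis by blast
qed

text \<open>The two preceding lemmas put the graph into the convex intersection. Conversely, every
  point of the lower hull lies above some point of the hull of the graph, every point of the upper
  hull lies below one, and heights in between are filled by vertical segments.\<close>

lemma convex_hull_ratio_graph:
  "convex hull ratio_graph =
    {(p, q, z). \<exists>z'\<le>z. (p, q, z') \<in> lower_hull} \<inter> {(p, q, z). \<exists>z'\<ge>z. (p, q, z') \<in> upper_hull}"
  (is "?G = ?L \<inter> ?U")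
proof
  have "convex ?L" "convex ?U"
    unfolding lower_hull_def upper_hull_def
    by (simp_all only: convex_upward convex_downward convex_convex_hull)
  moreover have "ratio_graph \<subseteq> ?L \<inter> ?U"
    using lower_hull_below_ratio upper_hull_above_ratio by (auto simp: ratio_graph_def)
  ultimately show "?G \<subseteq> ?L \<inter> ?U" by (intro hull_minimal convex_Int)
next
  have inc: "(p, q, (q / p) powr \<kappa>) \<in> ?G" if "(p, q) \<in> \<P>" for p q
    using that by (intro hull_inc) (simp add: ratio_graph_def)
  have ray: "oblique_edge r \<subseteq> {(p, q, z). \<exists>z'\<le>z. (p, q, z') \<in> ?G}"
    "oblique_edge r \<subseteq> {(p, q, z). \<exists>z'\<ge>z. (p, q, z') \<in> ?G}" for r
    using oblique_edge_subset[of r] hull_subset[of ratio_graph convex] by blast+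
  \<comment> \<open>The part added above the graph does no harm: each point still has a graph point
    below it.\<close>
  have "horizontal_edge c \<subseteq> {(p, q, z). \<exists>z'\<le>z. (p, q, z') \<in> ?G}" for c
    using inc by (auto simp: horizontal_edge_def)
  with ray have L: "lower_hull \<subseteq> {(p, q, z). \<exists>z'\<le>z. (p, q, z') \<in> ?G}"
    unfolding lower_hull_def by (intro hull_minimal convex_upward convex_convex_hull) simp
  have "vertical_edge c \<subseteq> {(p, q, z). \<exists>z'\<ge>z. (p, q, z') \<in> ?G}" for c
    using inc by (auto simp: vertical_edge_def)
  with ray have U: "upper_hull \<subseteq> {(p, q, z). \<exists>z'\<ge>z. (p, q, z') \<in> ?G}"
    unfolding upper_hull_def by (intro hull_minimal convex_downward convex_convex_hull) simp
  show "?L \<inter> ?U \<subseteq> ?G"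
  proof clarify
    fix p q z z1 z2
    assume "z1 \<le> z" "(p, q, z1) \<in> lower_hull" "z \<le> z2" "(p, q, z2) \<in> upper_hull"
    then have "\<exists>y1\<le>z1. (p, q, y1) \<in> ?G" "\<exists>y2\<ge>z2. (p, q, y2) \<in> ?G"
      using L U by blast+
    then obtain y1 y2 where y: "y1 \<le> z" "z \<le> y2" and G: "(p, q, y1) \<in> ?G" "(p, q, y2) \<in> ?G"
      using \<open>z1 \<le> z\<close> \<open>z \<le> z2\<close> by (meson order_trans)
    \<comment> \<open>The points at heights \<open>y1\<close> and \<open>y2\<close> have the same
      \<open>p\<close> and \<open>q\<close>, so the segment between them passes through height
      \<open>z\<close>.\<close>
    obtain t where t: "0 \<le> t" "t \<le> 1" and z: "z = (1 - t) * y1 + t * y2"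
      using between_convex_comb[OF y] .
    have "(1 - t) *\<^sub>R (p, q, y1) + t *\<^sub>R (p, q, y2) \<in> ?G"
      using G t by (intro convexD convex_convex_hull) auto
    then show "(p, q, z) \<in> ?G" by (simp add: z algebra_simps)
  qed
qed

lemma power_cone_representable_ratio_graph:
  assumes "a1 \<le> a2" "b1 \<le> b2"
  shows "power_cone_representable (convex hull ratio_graph)"
  unfolding convex_hull_ratio_graph
  using assms by (intro power_cone_representable_Int power_cone_representable_upward
      power_cone_representable_downward power_cone_representable_lower_hull
      power_cone_representable_upper_hull)

end

end

section \<open>The compression set\<close>

text \<open>\<open>L_plus\<close> with the flow ranging over the segment from \<open>0\<close> to \<open>F\<close>, whose sign is arbitrary, so that
  \<open>L_minus\<close> is the case \<open>F < 0\<close> after exchanging the two pressures.\<close>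
definition flow_set ::
    "real \<Rightarrow> real \<Rightarrow> real \<Rightarrow> real \<Rightarrow> real \<Rightarrow> real \<Rightarrow> real \<Rightarrow> real \<Rightarrow> real \<Rightarrow>
     (real \<times> real \<times> real \<times> real \<times> real) set" where
  "flow_set a1 a2 b1 b2 r1 r2 F H \<kappa> =
    {(p, q, f, l, x). x = 1 \<and> l = H * ((q / p) powr \<kappa> - 1) * f \<and>
      (p, q) \<in> Pi_ij a1 a2 b1 b2 r1 r2 \<and> f \<in> closed_segment 0 F}"

section \<open>The flow set and its two end slices\<close>

lemma convex_affine_vimage:
  assumes "linear f" "convex S"
  shows "convex {x. f x + d \<in> S}"
proof (rule convexI)
  fix x y and u v :: real
  assume uv: "0 \<le> u" "0 \<le> v" "u + v = 1" and xy: "x \<in> {x. f x + d \<in> S}" "y \<in> {x. f x + d \<in> S}"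
  have "u *\<^sub>R (f x + d) + v *\<^sub>R (f y + d) = f (u *\<^sub>R x + v *\<^sub>R y) + (u + v) *\<^sub>R d"
    using assms(1) by (simp add: linear_add linear_scale scaleR_add_right scaleR_add_left)
  moreover have "u *\<^sub>R (f x + d) + v *\<^sub>R (f y + d) \<in> S"
    using xy uv by (intro convexD[OF assms(2)]) auto
  ultimately show "u *\<^sub>R x + v *\<^sub>R y \<in> {x. f x + d \<in> S}"
    using uv by simp
qed

text \<open>For fixed pressures \<open>l\<close> is linear in \<open>f\<close>, so every point lies
  on a segment joining the slices \<open>f = 0\<close> and \<open>f = F\<close>. In the latter,
  \<open>l = H * F * (z - 1)\<close> for the ratio \<open>z\<close>, which inverts to
  \<open>z = l / (H * F) + 1\<close>.\<close>

lemma convex_hull_flow_set: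
  assumes "0 < H" "F \<noteq> 0"
  shows "convex hull (flow_set a1 a2 b1 b2 r1 r2 F H \<kappa>) = convex hull
    ({(p, q, f, l, x). (p, q) \<in> Pi_ij a1 a2 b1 b2 r1 r2 \<and> f = 0 \<and> l = 0 \<and> x = 1} \<union>
     {(p, q, f, l, x). (p, q, l / (H * F) + 1) \<in> convex hull (ratio_graph a1 a2 b1 b2 r1 r2 \<kappa>) \<and>
        f = F \<and> x = 1})" (is "?L = convex hull (?A \<union> ?B)")
proof
  show "?L \<subseteq> convex hull (?A \<union> ?B)"
  proof (rule hull_minimal)
    show "flow_set a1 a2 b1 b2 r1 r2 F H \<kappa> \<subseteq> convex hull (?A \<union> ?B)"
    proof clarify
      fix p q f l x assume *: "(p, q, f, l, x) \<in> flow_set a1 a2 b1 b2 r1 r2 F H \<kappa>"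
      then have pq: "(p, q) \<in> Pi_ij a1 a2 b1 b2 r1 r2" and x: "x = 1"
        and l: "l = H * ((q / p) powr \<kappa> - 1) * f" and "f \<in> closed_segment 0 F"
        by (simp_all add: flow_set_def)
      then obtain t where t: "0 \<le> t" "t \<le> 1" and f: "f = t * F"
        by (auto simp: closed_segment_def)
      have "(p, q, (q / p) powr \<kappa>) \<in> convex hull (ratio_graph a1 a2 b1 b2 r1 r2 \<kappa>)"
        using pq by (intro hull_inc) (simp add: ratio_graph_def)
      then have "(p, q, F, H * ((q / p) powr \<kappa> - 1) * F, 1) \<in> ?B"
        using assms by simp
      moreover have "(p, q, 0, 0, 1) \<in> ?A" using pq by simp
      ultimately have "(1 - t) *\<^sub>R (p, q, 0, 0, 1) + t *\<^sub>R (p, q, F, H * ((q / p) powr \<kappa> - 1) * F, 1)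
          \<in> convex hull (?A \<union> ?B)"
        using t by (intro convexD[OF convex_convex_hull] hull_inc) auto
      then show "(p, q, f, l, x) \<in> convex hull (?A \<union> ?B)"
        by (simp add: x l f algebra_simps)
    qed
  qed (rule convex_convex_hull)
next
  \<comment> \<open>The map \<open>?\<phi> y + ?d\<close> places a graph point in the slice
    \<open>f = F\<close>. The preimage of \<open>?L\<close> under it is convex and contains the
    graph, hence also its hull.\<close>
  let ?\<phi> = "\<lambda>(p, q, z). (p, q, 0, H * F * z, 0) :: real \<times> real \<times> real \<times> real \<times> real"
  let ?d = "(0, 0, F, - (H * F), 1) :: real \<times> real \<times> real \<times> real \<times> real"
  have "linear ?\<phi>" by (auto simp: linear_iff algebra_simps)
  then have "convex {y. ?\<phi> y + ?d \<in> ?L}"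
    by (intro convex_affine_vimage convex_convex_hull)
  moreover have "ratio_graph a1 a2 b1 b2 r1 r2 \<kappa> \<subseteq> {y. ?\<phi> y + ?d \<in> ?L}"
  proof
    fix y assume y: "y \<in> ratio_graph a1 a2 b1 b2 r1 r2 \<kappa>"
    obtain p q z where [simp]: "y = (p, q, z)" by (cases y)
    have "(p, q, F, H * (z - 1) * F, 1) \<in> flow_set a1 a2 b1 b2 r1 r2 F H \<kappa>"
      using y by (simp add: ratio_graph_def flow_set_def)
    then have "(p, q, F, H * (z - 1) * F, 1) \<in> ?L" by (rule hull_inc)
    then show "y \<in> {y. ?\<phi> y + ?d \<in> ?L}" by (simp add: algebra_simps)
  qed
  ultimately have hull: "convex hull (ratio_graph a1 a2 b1 b2 r1 r2 \<kappa>) \<subseteq> {y. ?\<phi> y + ?d \<in> ?L}"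
    by (intro hull_minimal)
  have "?B \<subseteq> ?L"
  proof clarify
    fix p q l assume "(p, q, l / (H * F) + 1) \<in> convex hull (ratio_graph a1 a2 b1 b2 r1 r2 \<kappa>)"
    then have "?\<phi> (p, q, l / (H * F) + 1) + ?d \<in> ?L" using hull by blast
    then show "(p, q, F, l, 1) \<in> ?L" using assms by (simp add: algebra_simps)
  qed
  moreover have "?A \<subseteq> ?L"
    by (rule order_trans[OF _ hull_subset]) (auto simp: flow_set_def)
  ultimately show "convex hull (?A \<union> ?B) \<subseteq> ?L"
    by (intro hull_minimal convex_convex_hull) simp
qed

text \<open>Treating the ratio as an independent coordinate with compact range puts the set inside a
  continuous image of a compact product.\<close>

lemma bounded_flow_set:
  assumes "0 < a1" "0 < b1" "0 < r1" "0 < \<kappa>" "\<kappa> < 1" "0 < H"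
  shows "bounded (flow_set a1 a2 b1 b2 r1 r2 F H \<kappa>)"
proof -
  let ?h = "\<lambda>(y :: real \<times> real \<times> real, f). (fst y, fst (snd y), f, H * (snd (snd y) - 1) * f, 1 :: real)"
  let ?K = "({a1..a2} \<times> {b1..b2} \<times> {0..r2 powr \<kappa>}) \<times> closed_segment 0 F"
  have "compact ?K" by (intro compact_Times compact_Icc compact_segment)
  moreover have "continuous_on ?K ?h"
    by (auto simp: case_prod_unfold intro!: continuous_intros)
  ultimately have "bounded (?h ` ?K)"
    by (intro compact_imp_bounded compact_continuous_image)
  moreover have "flow_set a1 a2 b1 b2 r1 r2 F H \<kappa> \<subseteq> ?h ` ?K"
  proof clarify
    fix p q f l x assume "(p, q, f, l, x) \<in> flow_set a1 a2 b1 b2 r1 r2 F H \<kappa>"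
    then have pq: "(p, q) \<in> Pi_ij a1 a2 b1 b2 r1 r2" and x: "x = 1"
      and l: "l = H * ((q / p) powr \<kappa> - 1) * f" and f: "f \<in> closed_segment 0 F"
      by (simp_all add: flow_set_def)
    have "p \<in> {a1..a2}" "q \<in> {b1..b2}" using pq by (auto simp: Pi_ij_def)
    moreover have "(q / p) powr \<kappa> \<in> {0..r2 powr \<kappa>}"
      using pq assms by (auto simp: Pi_ij_def intro: powr_mono2)
    ultimately show "(p, q, f, l, x) \<in> ?h ` ?K"
      using f by (intro image_eqI[of _ _ "((p, q, (q / p) powr \<kappa>), f)"]) (auto simp: x l)
  qed
  ultimately show ?thesis by (rule bounded_subset)
qed

lemma power_cone_representable_flow_set:
  assumes pos: "0 < a1" "0 < b1" "0 < r1" and \<kappa>: "0 < \<kappa>" "\<kappa> < 1" and HF: "0 < H" "F \<noteq> 0"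
    and ab: "a1 \<le> a2" "b1 \<le> b2"
  shows "power_cone_representable (convex hull (flow_set a1 a2 b1 b2 r1 r2 F H \<kappa>))"
proof -
  let ?G = "convex hull (ratio_graph a1 a2 b1 b2 r1 r2 \<kappa>)"
  let ?A = "{(p, q, f, l, x).
    (p, q) \<in> Pi_ij a1 a2 b1 b2 r1 r2 \<and> f = (0::real) \<and> l = (0::real) \<and> x = (1::real)}"
  let ?B = "{(p, q, f, l, x). (p, q, l / (H * F) + 1) \<in> ?G \<and> f = F \<and> x = (1::real)}"
  have "?A = {y. a1 \<le> fst y \<and> fst y \<le> a2 \<and> b1 \<le> fst (snd y) \<and> fst (snd y) \<le> b2 \<and>
      r1 * fst y \<le> fst (snd y) \<and> fst (snd y) \<le> r2 * fst y \<and> fst (snd (snd y)) = 0 \<and>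
      fst (snd (snd (snd y))) = 0 \<and> snd (snd (snd (snd y))) = 1}" (is "_ = ?S")
    using pos \<kappa> by (auto simp: Pi_ij_iff)
  moreover have "power_cone_representable ?S"
    by (intro power_cone_representable_intros) (simp_all add: linear_iff algebra_simps)
  ultimately have A: "power_cone_representable ?A" by simp
  have "power_cone_representable ?G"
    using assms by (intro power_cone_representable_ratio_graph)
  then have "power_cone_representable {y :: real \<times> real \<times> real \<times> real \<times> real.
      (fst y, fst (snd y), fst (snd (snd (snd y))) / (H * F)) + (0, 0, 1) \<in> ?G}"
    by (rule power_cone_representable_affine_vimage) (simp add: linear_iff add_divide_distrib)
  then have "power_cone_representable {y :: real \<times> real \<times> real \<times> real \<times> real.
      (fst y, fst (snd y), fst (snd (snd (snd y))) / (H * F)) + (0, 0, 1) \<in> ?G \<and>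
      fst (snd (snd y)) = F \<and> snd (snd (snd (snd y))) = 1}"
    by (intro power_cone_representable_intros) (simp_all add: linear_iff algebra_simps)
  then have B: "power_cone_representable ?B"
    by (simp add: case_prod_unfold)
  have "bounded (convex hull (flow_set a1 a2 b1 b2 r1 r2 F H \<kappa>))"
    using assms by (intro bounded_convex_hull bounded_flow_set)
  \<comment> \<open>Both slices inherit boundedness from the hull that contains them.\<close>
  then have "bounded ?A" "bounded ?B"
    unfolding convex_hull_flow_set[OF HF]
    using hull_subset[of "?A \<union> ?B" convex] by (meson bounded_subset le_sup_iff)+
  with A B show ?thesis
    unfolding convex_hull_flow_set[OF HF] by (intro power_cone_representable_convex_hull_Un)
qed

section \<open>Assembling the three pieces\<close>

lemma L_plus_eq_flow_set:
  assumes "0 < fu"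
  shows "L_plus a1 a2 b1 b2 r1 r2 fu H \<kappa> = flow_set a1 a2 b1 b2 r1 r2 fu H \<kappa>"
  using assms by (simp add: L_plus_def flow_set_def closed_segment_eq_real_ivl)

text \<open>Exchanging the pressures turns \<open>Pi_ji\<close> into \<open>Pi_ij\<close> with
  exchanged bounds, and the segment from 0 to the negative \<open>fl\<close> is
  \<open>{fl..0}\<close>.\<close>

lemma L_minus_eq_flow_set:
  assumes "fl < 0"
  shows "L_minus a1 a2 b1 b2 r1 r2 fl H \<kappa> =
    (\<lambda>(p, q, y). (q, p, y)) ` flow_set b1 b2 a1 a2 r1 r2 fl H \<kappa>"
  using assms
  by (force simp: L_minus_def flow_set_def closed_segment_eq_real_ivl Pi_ij_def Pi_ji_def)

theorem theorem2:
  fixes pl_i pu_i pl_j pu_j rl ru fl fu H \<kappa> :: real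
  assumes "0 < pl_i" "pl_i \<le> pu_i"
    and "0 < pl_j" "pl_j \<le> pu_j"
    and "fl < 0" "0 < fu"
    and "1 < rl" "rl < ru"
    and "H > 0"
    and "0 < \<kappa>" "\<kappa> < 1"
  shows "power_cone_representable
    (convex hull (compression_set pl_i pu_i pl_j pu_j rl ru fl fu H \<kappa>))"
proof -
  let ?LP = "L_plus pl_i pu_i pl_j pu_j rl ru fu H \<kappa>"
  let ?P = "convex hull ?LP"
  let ?LM = "L_minus pl_i pu_i pl_j pu_j rl ru fl H \<kappa>"
  let ?M = "convex hull ?LM"
  let ?Z = "L_zero pl_i pu_i pl_j pu_j"
  have P: "power_cone_representable ?P" "bounded ?P"
    using assms by (simp_all add: L_plus_eq_flow_set power_cone_representable_flow_set
        bounded_flow_set bounded_convex_hull)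
  let ?s = "\<lambda>(p, q, y). (q, p, y) :: real \<times> real \<times> real \<times> real \<times> real"
  have s: "linear ?s" by (auto simp: linear_iff)
  let ?N = "flow_set pl_j pu_j pl_i pu_i rl ru fl H \<kappa>"
  have M_eq: "?M = ?s ` (convex hull ?N)"
    using assms by (simp add: L_minus_eq_flow_set convex_hull_linear_image[OF s])
  \<comment> \<open>The swap is its own inverse, so its image is also a preimage; the summand 0 fits
    the form of the affine preimage rule.\<close>
  also have "\<dots> = {y. ?s y + 0 \<in> convex hull ?N}"
    by force
  also have "power_cone_representable \<dots>"
    using assms s
    by (intro power_cone_representable_affine_vimage power_cone_representable_flow_set) auto
  finally have "power_cone_representable ?M" .
  moreover have "bounded ?M"
    unfolding M_eq using assms s
    by (intro bounded_linear_image bounded_convex_hull bounded_flow_set)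
      (simp_all add: linear_conv_bounded_linear)
  moreover have "power_cone_representable ?Z"
  proof -
    have "?Z = {y. fst (snd (snd y)) = 0 \<and> fst (snd (snd (snd y))) = 0 \<and> snd (snd (snd (snd y))) = 0 \<and>
        pl_i \<le> fst y \<and> fst y \<le> pu_i \<and> pl_j \<le> fst (snd y) \<and> fst (snd y) \<le> pu_j}" (is "_ = ?S")
      by (auto simp: L_zero_def)
    moreover have "power_cone_representable ?S"
      by (intro power_cone_representable_intros) (simp_all add: linear_iff algebra_simps)
    ultimately show ?thesis by simp
  qed
  moreover have "bounded ?Z"
  proof (rule bounded_subset)
    show "bounded ({pl_i..pu_i} \<times> {pl_j..pu_j} \<times> {0::real} \<times> {0::real} \<times> {0::real})"
      by (intro bounded_Times bounded_closed_interval) auto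
  qed (auto simp: L_zero_def)
  ultimately have "power_cone_representable (convex hull \<Union>{?P, ?M, ?Z})"
    using P by (intro power_cone_representable_convex_hull_Union) auto
  also have "\<Union>{?P, ?M, ?Z} = ?P \<union> (?M \<union> ?Z)"
    by auto
  also have "convex hull (?P \<union> (?M \<union> ?Z)) = convex hull (?LP \<union> (?M \<union> ?Z))"
    by (rule hull_Un_left[symmetric])
  also have "?LP \<union> (?M \<union> ?Z) = ?M \<union> (?LP \<union> ?Z)"
    by (rule Un_left_commute)
  also have "convex hull (?M \<union> (?LP \<union> ?Z)) = convex hull (?LM \<union> (?LP \<union> ?Z))"
    by (rule hull_Un_left[symmetric])
  also have "?LM \<union> (?LP \<union> ?Z) = compression_set pl_i pu_i pl_j pu_j rl ru fl fu H \<kappa>"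
    by (simp only: compression_set_def Un_ac)
  finally show ?thesis .
qed

end
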